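(* Let $(\mathcal R,\exp)$ be an exponential field which is a model of $\mathsf{MaxVal}(\exp)$ and satisfies $\exp(1)=2$. Let $\mathcal M\subseteq\mathcal R$ be a discretely ordered ring such that $(\mathcal M,\exp)$ is an exponential integer part of $(\mathcal R,\exp)$. Then $(\mathcal M^+,\exp|_{M^+})$, with $S(x)$ interpreted as $x+1$, is a model of $\mathsf{IOpen}(\exp)$.
   Context: An exponential field is an ordered field $\mathcal F$ with a map $\exp\colon F\to F^{>0}$ that is an order-preserving isomorphism from $(F,+)$ onto $(F^{>0},\cdot)$. $\mathsf{MaxVal}(\exp)$ is the scheme consisting, for every term $t(x,\bar w)$ of the language $\mathcal L_{OR}(\exp)=(+,\cdot,0,1,\leqslant,\exp)$, of the sentence $\forall\bar w\,\forall x,y\,\big(x<y\to\exists z_{\max}\in[x,y]\,\forall z\in[x,y]\;t(z,\bar w)\leqslant t(z_{\max},\bar w)\big)$. A discretely ordered ring is an ordered (commutative unital) ring in which $1$ is the least positive element; $M^+=\{m\in M:m\geqslant0\}$. If $\mathcal M\subseteq\mathcal R$ with $\mathcal M$ discretely ordered, $\mathcal M$ is an integer part of $\mathcal R$ if for each $r\in R$ there is $m\in M$ with $m\leqslant r<m+1$; $(\mathcal M,\exp)$ is an exponential integer part of $(\mathcal R,\exp)$ if moreover $\exp(m)\in M^+$ for all $m\in M^+$. The theory $\mathsf{IOpen}(\exp)$ in the language $(0,S,+,\cdot,\leqslant,\exp)$ consists of: (Q1) $Sx\neq0$; (Q2) $Sx=Sy\to x=y$; (Q3) $x\neq0\to\exists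 y\,(x=Sy)$; (Q4) $x+0=x$; (Q5) $x+Sy=S(x+y)$; (Q6) $x\cdot0=0$; (Q7) $x\cdot Sy=x\cdot y+x$; (Q8) $x\leqslant y\leftrightarrow\exists r\,(r+x=y)$; (E1) $\exp(0)=S(0)$; (E2) $\exp(S(x))=\exp(x)+\exp(x)$; and the induction scheme $\big(\varphi(0,\bar y)\wedge\forall x(\varphi(x,\bar y)\to\varphi(S(x),\bar y))\big)\to\forall x\,\varphi(x,\bar y)$ for every quantifier-free formula $\varphi$ of this language. *)

theory Defs
  imports Main
begin

section \<open>Exponential fields and MaxVal(exp)\<close>

text \<open>The underlying ordered field is a whole type of class \<open>linordered_field\<close>.\<close>

definition exponential_field :: "('a::linordered_field \<Rightarrow> 'a) \<Rightarrow> bool" where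
  "exponential_field E \<longleftrightarrow>
     bij_betw E UNIV {0<..} \<and>
     (\<forall>x y. E (x + y) = E x * E y) \<and>
     (\<forall>x y. x \<le> y \<longleftrightarrow> E x \<le> E y)"

datatype or_term =
    OVar nat
  | OZero
  | OOne
  | OAdd or_term or_term
  | OMul or_term or_term
  | OExp or_term

primrec or_eval :: "('a::linordered_field \<Rightarrow> 'a) \<Rightarrow> (nat \<Rightarrow> 'a) \<Rightarrow> or_term \<Rightarrow> 'a" where
  "or_eval E e (OVar n) = e n"
| "or_eval E e OZero = 0"
| "or_eval E e OOne = 1"
| "or_eval E e (OAdd s t) = or_eval E e s + or_eval E e t"
| "or_eval E e (OMul s t) = or_eval E e s * or_eval E e t"
| "or_eval E e (OExp t) = E (or_eval E e t)"

text \<open>In \<open>t(x, w)\<close> the variable \<open>x\<close> is \<open>OVar i\<close>; the assignment \<open>e\<close> supplies the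
  parameters \<open>w\<close>.\<close>

definition MaxVal_exp :: "('a::linordered_field \<Rightarrow> 'a) \<Rightarrow> bool" where
  "MaxVal_exp E \<longleftrightarrow>
     (\<forall>t i e x y. x < y \<longrightarrow>
        (\<exists>zmax\<in>{x..y}. \<forall>z\<in>{x..y}. or_eval E (e(i := z)) t \<le> or_eval E (e(i := zmax)) t))"


section \<open>Exponential integer parts\<close>

definition discretely_ordered_subring :: "'a::linordered_field set \<Rightarrow> bool" where
  "discretely_ordered_subring M \<longleftrightarrow>
     0 \<in> M \<and> 1 \<in> M \<and>
     (\<forall>a\<in>M. \<forall>b\<in>M. a + b \<in> M) \<and>
     (\<forall>a\<in>M. - a \<in> M) \<and>
     (\<forall>a\<in>M. \<forall>b\<in>M. a * b \<in> M) \<and>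
     (\<forall>a\<in>M. 0 < a \<longrightarrow> 1 \<le> a)"

definition nonneg_part :: "'a::linordered_field set \<Rightarrow> 'a set" where
  "nonneg_part M = {m \<in> M. 0 \<le> m}"

definition integer_part :: "'a::linordered_field set \<Rightarrow> bool" where
  "integer_part M \<longleftrightarrow>
     discretely_ordered_subring M \<and> (\<forall>r. \<exists>m\<in>M. m \<le> r \<and> r < m + 1)"

definition exponential_integer_part ::
    "('a::linordered_field \<Rightarrow> 'a) \<Rightarrow> 'a set \<Rightarrow> bool" where
  "exponential_integer_part E M \<longleftrightarrow>
     integer_part M \<and> (\<forall>m\<in>nonneg_part M. E m \<in> nonneg_part M)"


section \<open>The theory IOpen(exp)\<close>

datatype ar_term =
    Var nat
  | Zero
  | Succ ar_term
  | Add ar_term ar_term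
  | Mul ar_term ar_term
  | Exp ar_term

datatype open_formula =
    Eq ar_term ar_term
  | Le ar_term ar_term
  | Neg open_formula
  | Conj open_formula open_formula
  | Disj open_formula open_formula
  | Impl open_formula open_formula

text \<open>Structures for the language \<open>(0, S, +, \<cdot>, \<le>, exp)\<close>. The operations are total on the type
  \<open>'a\<close>, but only their restrictions to the domain \<open>D\<close> matter.\<close>

locale exp_arith_structure =
  fixes D :: "'a set"
    and zer :: 'a
    and S :: "'a \<Rightarrow> 'a"
    and add :: "'a \<Rightarrow> 'a \<Rightarrow> 'a"  (infixl \<open>\<oplus>\<close> 65)
    and mul :: "'a \<Rightarrow> 'a \<Rightarrow> 'a"  (infixl \<open>\<odot>\<close> 70)
    and leq :: "'a \<Rightarrow> 'a \<Rightarrow> bool"  (infix \<open>\<preceq>\<close> 50)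
    and ex :: "'a \<Rightarrow> 'a"
  assumes zer_closed: "zer \<in> D"
    and S_closed: "x \<in> D \<Longrightarrow> S x \<in> D"
    and add_closed: "x \<in> D \<Longrightarrow> y \<in> D \<Longrightarrow> x \<oplus> y \<in> D"
    and mul_closed: "x \<in> D \<Longrightarrow> y \<in> D \<Longrightarrow> x \<odot> y \<in> D"
    and ex_closed: "x \<in> D \<Longrightarrow> ex x \<in> D"
begin

primrec eval :: "(nat \<Rightarrow> 'a) \<Rightarrow> ar_term \<Rightarrow> 'a" where
  "eval e (Var n) = e n"
| "eval e Zero = zer"
| "eval e (Succ t) = S (eval e t)"
| "eval e (Add s t) = eval e s \<oplus> eval e t"
| "eval e (Mul s t) = eval e s \<odot> eval e t"
| "eval e (Exp t) = ex (eval e t)"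

primrec sat :: "(nat \<Rightarrow> 'a) \<Rightarrow> open_formula \<Rightarrow> bool" where
  "sat e (Eq s t) \<longleftrightarrow> eval e s = eval e t"
| "sat e (Le s t) \<longleftrightarrow> eval e s \<preceq> eval e t"
| "sat e (Neg p) \<longleftrightarrow> \<not> sat e p"
| "sat e (Conj p q) \<longleftrightarrow> sat e p \<and> sat e q"
| "sat e (Disj p q) \<longleftrightarrow> sat e p \<or> sat e q"
| "sat e (Impl p q) \<longleftrightarrow> (sat e p \<longrightarrow> sat e q)"

end

text \<open>In the induction scheme the induction variable is \<open>Var i\<close>; the assignment \<open>e\<close> supplies the
  parameters, which range over \<open>D\<close>.\<close>

locale IOpen_exp_model = exp_arith_structure +
  assumes Q1: "\<forall>x\<in>D. S x \<noteq> zer"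
    and Q2: "\<forall>x\<in>D. \<forall>y\<in>D. S x = S y \<longrightarrow> x = y"
    and Q3: "\<forall>x\<in>D. x \<noteq> zer \<longrightarrow> (\<exists>y\<in>D. x = S y)"
    and Q4: "\<forall>x\<in>D. x \<oplus> zer = x"
    and Q5: "\<forall>x\<in>D. \<forall>y\<in>D. x \<oplus> S y = S (x \<oplus> y)"
    and Q6: "\<forall>x\<in>D. x \<odot> zer = zer"
    and Q7: "\<forall>x\<in>D. \<forall>y\<in>D. x \<odot> S y = (x \<odot> y) \<oplus> x"
    and Q8: "\<forall>x\<in>D. \<forall>y\<in>D. x \<preceq> y \<longleftrightarrow> (\<exists>r\<in>D. r \<oplus> x = y)"
    and E1: "ex zer = S zer"
    and E2: "\<forall>x\<in>D. ex (S x) = ex x \<oplus> ex x"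
    and open_induction: "\<forall>p i e. range e \<subseteq> D \<longrightarrow>
       sat (e(i := zer)) p \<and> (\<forall>x\<in>D. sat (e(i := x)) p \<longrightarrow> sat (e(i := S x)) p) \<longrightarrow>
       (\<forall>x\<in>D. sat (e(i := x)) p)"

end

theory Submission
  imports Defs
begin

text \<open>The minimum of \<open>E x - x\<close> on \<open>[0, 1]\<close> is attained at an interior point because \<open>E 1 = 2\<close>, and
  this forces \<open>E\<close> to be differentiable with \<open>E' = k E\<close> for a constant \<open>k\<close>. Hence the one-variable
  functions given by terms with parameters are closed under differentiation, and \<open>MaxVal(exp)\<close>
  yields Rolle's theorem for them. Consequently, if the sign of \<open>f'\<close> is constant between
  consecutive points of a finite set, then the same holds for \<open>f\<close>. Every such function can be
  turned into \<open>0\<close> by finitely many differentiations and multiplications by exponentials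
  \<open>E h\<close>, so the sign of every such function is piecewise constant. A piecewise constant property
  satisfies induction in an integer part, as one can pass the finitely many break points one
  after the other.\<close>

section \<open>Continuity and derivatives in ordered fields\<close>

definition continuous_at :: "('a::linordered_field \<Rightarrow> 'a) \<Rightarrow> 'a \<Rightarrow> bool" where
  "continuous_at f x \<longleftrightarrow> (\<forall>e>0. \<exists>d>0. \<forall>y. \<bar>y - x\<bar> < d \<longrightarrow> \<bar>f y - f x\<bar> < e)"

lemma continuous_atD:
  assumes "continuous_at f x" "0 < e"
  obtains d where "0 < d" "\<And>y. \<bar>y - x\<bar> < d \<Longrightarrow> \<bar>f y - f x\<bar> < e"
  using assms unfolding continuous_at_def by blast

lemma continuous_at_const: "continuous_at (\<lambda>_. c) x"
  by (auto simp: continuous_at_def intro: exI[of _ 1])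

lemma continuous_at_id: "continuous_at (\<lambda>y. y) x"
  unfolding continuous_at_def by blast

lemma continuous_at_add:
  assumes "continuous_at f x" "continuous_at g x"
  shows "continuous_at (\<lambda>y. f y + g y) x"
  unfolding continuous_at_def
proof (intro allI impI)
  fix e :: 'a
  assume "0 < e"
  then have e2: "0 < e / 2" by simp
  obtain d1 where d1: "0 < d1" "\<And>y. \<bar>y - x\<bar> < d1 \<Longrightarrow> \<bar>f y - f x\<bar> < e / 2"
    using continuous_atD[OF assms(1) e2] by blast
  obtain d2 where d2: "0 < d2" "\<And>y. \<bar>y - x\<bar> < d2 \<Longrightarrow> \<bar>g y - g x\<bar> < e / 2"
    using continuous_atD[OF assms(2) e2] by blast
  have "\<bar>f y + g y - (f x + g x)\<bar> < e" if "\<bar>y - x\<bar> < min d1 d2" for y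
  proof -
    have "\<bar>f y + g y - (f x + g x)\<bar> \<le> \<bar>f y - f x\<bar> + \<bar>g y - g x\<bar>"
      using abs_triangle_ineq[of "f y - f x" "g y - g x"] by (simp add: algebra_simps)
    also have "\<dots> < e / 2 + e / 2"
      using that by (intro add_strict_mono d1(2) d2(2)) auto
    finally show ?thesis by simp
  qed
  then show "\<exists>d>0. \<forall>y. \<bar>y - x\<bar> < d \<longrightarrow> \<bar>f y + g y - (f x + g x)\<bar> < e"
    using d1(1) d2(1) by (intro exI[of _ "min d1 d2"]) auto
qed

lemma continuous_at_mult:
  assumes "continuous_at f x" "continuous_at g x"
  shows "continuous_at (\<lambda>y. f y * g y) x"
  unfolding continuous_at_def
proof (intro allI impI)
  fix e :: 'a
  assume e: "0 < e"
  \<comment> \<open>\<open>F\<close> bounds \<open>f\<close> in absolute value near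
    \<open>x\<close>, where \<open>f\<close> moves by less than 1; the summand 1 also keeps both
    divisors below positive.\<close>
  define F where "F = \<bar>f x\<bar> + 1"
  define G where "G = \<bar>g x\<bar> + 1"
  define a where "a = e / 2 / G"
  define b where "b = e / 2 / F"
  have pos: "0 < F" "0 < G"
    by (simp_all add: F_def G_def add_nonneg_pos)
  have ab: "0 < min 1 a" "0 < b"
    using e pos by (simp_all add: a_def b_def)
  obtain d1 where d1: "0 < d1" "\<And>y. \<bar>y - x\<bar> < d1 \<Longrightarrow> \<bar>f y - f x\<bar> < min 1 a"
    using continuous_atD[OF assms(1) ab(1)] by blast
  obtain d2 where d2: "0 < d2" "\<And>y. \<bar>y - x\<bar> < d2 \<Longrightarrow> \<bar>g y - g x\<bar> < b"
    using continuous_atD[OF assms(2) ab(2)] by blast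
  have "\<bar>f y * g y - f x * g x\<bar> < e" if y: "\<bar>y - x\<bar> < min d1 d2" for y
  proof -
    have f1: "\<bar>f y - f x\<bar> < 1" and f2: "\<bar>f y - f x\<bar> < a" and g1: "\<bar>g y - g x\<bar> < b"
      using d1(2)[of y] d2(2)[of y] y by auto
    have fy: "\<bar>f y\<bar> \<le> F"
      using f1 unfolding F_def by linarith
    have "f y * g y - f x * g x = f y * (g y - g x) + g x * (f y - f x)"
      by (simp add: algebra_simps)
    then have "\<bar>f y * g y - f x * g x\<bar> \<le> \<bar>f y\<bar> * \<bar>g y - g x\<bar> + \<bar>g x\<bar> * \<bar>f y - f x\<bar>"
      by (metis abs_mult abs_triangle_ineq)
    also have "\<dots> \<le> F * \<bar>g y - g x\<bar> + G * \<bar>f y - f x\<bar>"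
      using fy by (intro add_mono mult_right_mono) (auto simp: G_def)
    also have "\<dots> < F * b + G * a"
      using f2 g1 pos by (intro add_strict_mono mult_strict_left_mono)
    also have "\<dots> = e / 2 + e / 2"
      using pos by (simp add: a_def b_def)
    finally show ?thesis by simp
  qed
  then show "\<exists>d>0. \<forall>y. \<bar>y - x\<bar> < d \<longrightarrow> \<bar>f y * g y - f x * g x\<bar> < e"
    using d1(1) d2(1) by (intro exI[of _ "min d1 d2"]) auto
qed

lemma continuous_at_compose:
  assumes "continuous_at g x" "continuous_at f (g x)"
  shows "continuous_at (\<lambda>y. f (g y)) x"
  unfolding continuous_at_def
proof (intro allI impI)
  fix e :: 'a
  assume "0 < e"
  then obtain r where r: "0 < r" "\<And>y. \<bar>y - g x\<bar> < r \<Longrightarrow> \<bar>f y - f (g x)\<bar> < e"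
    using continuous_atD[OF assms(2)] by blast
  then obtain d where "0 < d" "\<And>y. \<bar>y - x\<bar> < d \<Longrightarrow> \<bar>g y - g x\<bar> < r"
    using continuous_atD[OF assms(1)] by blast
  then show "\<exists>d>0. \<forall>y. \<bar>y - x\<bar> < d \<longrightarrow> \<bar>f (g y) - f (g x)\<bar> < e"
    using r(2) by blast
qed

lemma continuous_at_pos:
  assumes "continuous_at f x" "0 < f x"
  obtains d where "0 < d" "\<And>y. \<bar>y - x\<bar> < d \<Longrightarrow> 0 < f y"
proof -
  obtain d where d: "0 < d" "\<And>y. \<bar>y - x\<bar> < d \<Longrightarrow> \<bar>f y - f x\<bar> < f x"
    using continuous_atD[OF assms] by blast
  have "0 < f y" if "\<bar>y - x\<bar> < d" for y
    using d(2)[OF that] by linarith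
  with d(1) that show thesis by blast
qed

text \<open>Caratheodory's form of the derivative: the sum, product and chain rules become algebraic
  identities.\<close>

definition has_derivative_at :: "('a::linordered_field \<Rightarrow> 'a) \<Rightarrow> 'a \<Rightarrow> 'a \<Rightarrow> bool" where
  "has_derivative_at f D x \<longleftrightarrow>
     (\<exists>q. continuous_at q x \<and> q x = D \<and> (\<forall>y. f y = f x + q y * (y - x)))"

lemma has_derivative_atI:
  assumes "continuous_at q x" "q x = D" "\<And>y. f y = f x + q y * (y - x)"
  shows "has_derivative_at f D x"
  using assms unfolding has_derivative_at_def by blast

lemma has_derivative_at_continuous:
  assumes "has_derivative_at f D x"
  shows "continuous_at f x"
proof -
  obtain q where q: "continuous_at q x" "\<And>y. f y = f x + q y * (y - x)"
    using assms unfolding has_derivative_at_def by blast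
  have "continuous_at (\<lambda>y. f x + q y * (y + - x)) x"
    by (intro continuous_at_add continuous_at_mult continuous_at_const continuous_at_id q(1))
  moreover have "f x + q y * (y + - x) = f y" for y
    using q(2)[of y] by simp
  ultimately show ?thesis by simp
qed

lemma has_derivative_at_const: "has_derivative_at (\<lambda>_. c) 0 x"
  unfolding has_derivative_at_def by (rule exI[of _ "\<lambda>_. 0"]) (simp add: continuous_at_const)

lemma has_derivative_at_id: "has_derivative_at (\<lambda>y. y) 1 x"
  unfolding has_derivative_at_def by (rule exI[of _ "\<lambda>_. 1"]) (simp add: continuous_at_const)

lemma has_derivative_at_add:
  assumes "has_derivative_at f D x" "has_derivative_at g D' x"
  shows "has_derivative_at (\<lambda>y. f y + g y) (D + D') x"
proof -
  obtain p where p: "continuous_at p x" "p x = D" "\<And>y. f y = f x + p y * (y - x)"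
    using assms(1) unfolding has_derivative_at_def by blast
  obtain q where q: "continuous_at q x" "q x = D'" "\<And>y. g y = g x + q y * (y - x)"
    using assms(2) unfolding has_derivative_at_def by blast
  show ?thesis
  proof (rule has_derivative_atI)
    show "continuous_at (\<lambda>y. p y + q y) x"
      by (intro continuous_at_add p(1) q(1))
    show "p x + q x = D + D'"
      by (simp add: p(2) q(2))
    show "f y + g y = f x + g x + (p y + q y) * (y - x)" for y
      by (subst p(3), subst q(3)) (simp add: algebra_simps)
  qed
qed

lemma has_derivative_at_mult:
  assumes "has_derivative_at f D x" "has_derivative_at g D' x"
  shows "has_derivative_at (\<lambda>y. f y * g y) (D * g x + f x * D') x"
proof -
  obtain p where p: "continuous_at p x" "p x = D" "\<And>y. f y = f x + p y * (y - x)"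
    using assms(1) unfolding has_derivative_at_def by blast
  obtain q where q: "continuous_at q x" "q x = D'" "\<And>y. g y = g x + q y * (y - x)"
    using assms(2) unfolding has_derivative_at_def by blast
  show ?thesis
  proof (rule has_derivative_atI)
    \<comment> \<open>Changing first \<open>g\<close> and then \<open>f\<close> gives this quotient.
      Its second summand contains \<open>f y\<close>, so the continuity of \<open>f\<close>
      enters.\<close>
    show "continuous_at (\<lambda>y. p y * g x + f y * q y) x"
      using p(1) q(1) has_derivative_at_continuous[OF assms(1)]
      by (intro continuous_at_add continuous_at_mult continuous_at_const)
    show "p x * g x + f x * q x = D * g x + f x * D'"
      by (simp add: p(2) q(2))
    fix y
    have "f y * g y = f y * g x + f y * q y * (y - x)"
      by (subst q(3)) (simp add: algebra_simps)
    also have "f y * g x = f x * g x + p y * g x * (y - x)"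
      by (subst p(3)) (simp add: algebra_simps)
    finally show "f y * g y = f x * g x + (p y * g x + f y * q y) * (y - x)"
      by (simp add: algebra_simps)
  qed
qed

lemma has_derivative_at_compose:
  assumes "has_derivative_at g D x" "has_derivative_at f D' (g x)"
  shows "has_derivative_at (\<lambda>y. f (g y)) (D' * D) x"
proof -
  obtain p where p: "continuous_at p x" "p x = D" "\<And>y. g y = g x + p y * (y - x)"
    using assms(1) unfolding has_derivative_at_def by blast
  obtain q where q: "continuous_at q (g x)" "q (g x) = D'"
    "\<And>y. f y = f (g x) + q y * (y - g x)"
    using assms(2) unfolding has_derivative_at_def by blast
  show ?thesis
  proof (rule has_derivative_atI)
    show "continuous_at (\<lambda>y. q (g y) * p y) x"
      using p(1) q(1) has_derivative_at_continuous[OF assms(1)]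
      by (intro continuous_at_mult continuous_at_compose[of g x q])
    show "q (g x) * p x = D' * D"
      by (simp add: p(2) q(2))
    fix y
    have "g y - g x = p y * (y - x)"
      using p(3)[of y] by simp
    then show "f (g y) = f (g x) + (q (g y) * p y) * (y - x)"
      using q(3)[of "g y"] by (simp add: mult.assoc)
  qed
qed

lemma has_derivative_at_uminus:
  assumes "has_derivative_at f D x"
  shows "has_derivative_at (\<lambda>y. - f y) (- D) x"
  using has_derivative_at_mult[OF has_derivative_at_const[of "- 1"] assms] by simp

text \<open>If \<open>D\<close> were positive, the Caratheodory quotient would be positive near
  \<open>z\<close>, and \<open>f\<close> would exceed \<open>f z\<close> just to the right. The
  one-sided form also serves for a maximum at an endpoint of an interval.\<close>

lemma has_derivative_at_right_max:
  assumes "has_derivative_at f D z" "z < b" and max: "\<And>y. z < y \<Longrightarrow> y < b \<Longrightarrow> f y \<le> f z"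
  shows "D \<le> 0"
proof (rule ccontr)
  assume "\<not> D \<le> 0"
  obtain q where q: "continuous_at q z" "q z = D" "\<And>y. f y = f z + q y * (y - z)"
    using assms(1) unfolding has_derivative_at_def by blast
  then obtain d where d: "0 < d" "\<And>y. \<bar>y - z\<bar> < d \<Longrightarrow> 0 < q y"
    using continuous_at_pos[of q z] \<open>\<not> D \<le> 0\<close> by auto
  obtain t where t: "0 < t" "t < min d (b - z)"
    using dense[of 0 "min d (b - z)"] d(1) assms(2) by auto
  have "0 < q (z + t)"
    using t by (intro d(2)) auto
  then have "f z < f (z + t)"
    using q(3)[of "z + t"] t(1) by simp
  moreover have "f (z + t) \<le> f z"
    using t by (intro max) auto
  ultimately show False by simp
qed

text \<open>Reflection at 0 exchanges the two sides and changes the sign of the derivative.\<close>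

lemma has_derivative_at_left_max:
  assumes "has_derivative_at f D z" "a < z" and max: "\<And>y. a < y \<Longrightarrow> y < z \<Longrightarrow> f y \<le> f z"
  shows "0 \<le> D"
proof -
  have "has_derivative_at (\<lambda>y. f (- y)) (D * - 1) (- z)"
    using assms(1)
    by (intro has_derivative_at_compose has_derivative_at_uminus has_derivative_at_id) simp
  then have "D * - 1 \<le> 0"
    using assms(2) max by (intro has_derivative_at_right_max[of _ _ "- z" "- a"]) auto
  then show ?thesis by simp
qed

lemma has_derivative_at_local_max:
  assumes "has_derivative_at f D z" "a < z" "z < b"
    and "\<And>y. a < y \<Longrightarrow> y < b \<Longrightarrow> f y \<le> f z"
  shows "D = 0"
proof (rule antisym)
  show "D \<le> 0"
    by (rule has_derivative_at_right_max[of f D z b]) (use assms in auto)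
  show "0 \<le> D"
    by (rule has_derivative_at_left_max[of f D z a]) (use assms in auto)
qed


section \<open>Piecewise constant functions\<close>

text \<open>Speaking of closed intervals that avoid \<open>B\<close> treats bounded and unbounded
  pieces alike and leaves the values at the break points arbitrary.\<close>

definition piecewise_const :: "('a::linorder \<Rightarrow> 'b) \<Rightarrow> bool" where
  "piecewise_const g \<longleftrightarrow>
     (\<exists>B. finite B \<and> (\<forall>x y. x \<le> y \<longrightarrow> {x..y} \<inter> B = {} \<longrightarrow> g x = g y))"

lemma piecewise_constI:
  assumes "finite B" "\<And>x y. x \<le> y \<Longrightarrow> {x..y} \<inter> B = {} \<Longrightarrow> g x = g y"
  shows "piecewise_const g"
  using assms unfolding piecewise_const_def by blast

lemma piecewise_const_compose: "piecewise_const g \<Longrightarrow> piecewise_const (\<lambda>x. h (g x))"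
  unfolding piecewise_const_def by metis

lemma piecewise_const_combine:
  assumes "piecewise_const f" "piecewise_const g"
  shows "piecewise_const (\<lambda>x. h (f x) (g x))"
proof -
  obtain A where A: "finite A" "\<And>x y. x \<le> y \<Longrightarrow> {x..y} \<inter> A = {} \<Longrightarrow> f x = f y"
    using assms(1) unfolding piecewise_const_def by blast
  obtain B where B: "finite B" "\<And>x y. x \<le> y \<Longrightarrow> {x..y} \<inter> B = {} \<Longrightarrow> g x = g y"
    using assms(2) unfolding piecewise_const_def by blast
  show ?thesis
  proof (rule piecewise_constI[of "A \<union> B"])
    show "finite (A \<union> B)" using A(1) B(1) by simp
    fix x y
    assume "x \<le> y" "{x..y} \<inter> (A \<union> B) = {}"
    then have "f x = f y" "g x = g y"
      by (auto intro!: A(2) B(2))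
    then show "h (f x) (g x) = h (f y) (g y)" by simp
  qed
qed

text \<open>Strong induction on the number of break points up to \<open>m\<close>, a finite number
  even when \<open>m\<close> is infinitely large. Let \<open>b\<close> be the last break point in
  \<open>{0..m}\<close> and \<open>j\<close> its integer part. Fewer break points lie below
  \<open>j - 1\<close>, so \<open>P (j - 1)\<close> holds; two steps lead across \<open>b\<close> to
  \<open>j + 1\<close>, and no break point separates \<open>j + 1\<close> from
  \<open>m\<close>.\<close>

lemma integer_part_induct:
  assumes M: "integer_part M" and P: "piecewise_const P" and P0: "P 0"
    and step: "\<And>x. x \<in> nonneg_part M \<Longrightarrow> P x \<Longrightarrow> P (x + 1)"
    and m: "m \<in> nonneg_part M"
  shows "P m"
proof -
  have ring: "0 \<in> M" "1 \<in> M" "\<And>a b. a \<in> M \<Longrightarrow> b \<in> M \<Longrightarrow> a + b \<in> M" "\<And>a. a \<in> M \<Longrightarrow> - a \<in> M"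
    and discrete: "\<And>a. a \<in> M \<Longrightarrow> 0 < a \<Longrightarrow> 1 \<le> a"
    using M unfolding integer_part_def discretely_ordered_subring_def by auto
  have diff: "a - b \<in> M" if "a \<in> M" "b \<in> M" for a b
    using ring(3)[of a "- b"] ring(4) that by simp
  obtain B where B: "finite B" "\<And>x y. x \<le> y \<Longrightarrow> {x..y} \<inter> B = {} \<Longrightarrow> P x = P y"
    using P unfolding piecewise_const_def by blast
  show ?thesis
    using m
  proof (induction "card {b \<in> B. b \<le> m}" arbitrary: m rule: less_induct)
    case less
    then have m: "m \<in> M" "0 \<le> m"
      by (auto simp: nonneg_part_def)
    show ?case
    proof (cases "{0..m} \<inter> B = {}")
      case True
      then show ?thesis
        using B(2)[OF m(2)] P0 by simp
    next
      case False
      define b where "b = Max ({0..m} \<inter> B)"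
      have b: "b \<in> {0..m} \<inter> B"
        unfolding b_def using False B(1) by (intro Max_in) auto
      have b_max: "c \<le> b" if "c \<in> {0..m} \<inter> B" for c
        unfolding b_def using that B(1) by (intro Max_ge) auto
      obtain j where j: "j \<in> M" "j \<le> b" "b < j + 1"
        using M unfolding integer_part_def by blast
      have "0 < j + 1"
        using b j(3) by auto
      then have j0: "0 \<le> j"
        using discrete[of "j + 1"] ring j(1) by auto
      have Pj: "P j"
      proof (cases "j = 0")
        case True
        then show ?thesis using P0 by simp
      next
        case False
        then have "1 \<le> j"
          using discrete[of j] j(1) j0 by simp
        \<comment> \<open>The break point \<open>b\<close> may equal \<open>j\<close>, so only
          \<open>j - 1\<close> is certain to leave \<open>b\<close> out of the count.\<close>
        then have j1: "j - 1 \<in> nonneg_part M"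
          using diff j(1) ring(2) by (simp add: nonneg_part_def)
        have "{c \<in> B. c \<le> j - 1} \<subset> {c \<in> B. c \<le> m}"
        proof
          have "j - 1 \<le> m"
            using j(2) b by auto
          then show "{c \<in> B. c \<le> j - 1} \<subseteq> {c \<in> B. c \<le> m}"
            by auto
          have "b \<in> {c \<in> B. c \<le> m}" "b \<notin> {c \<in> B. c \<le> j - 1}"
            using b j(2) by auto
          then show "{c \<in> B. c \<le> j - 1} \<noteq> {c \<in> B. c \<le> m}"
            by blast
        qed
        then have "P (j - 1)"
          using less.hyps j1 B(1) by (simp add: psubset_card_mono)
        then show ?thesis
          using step[OF j1] by simp
      qed
      show ?thesis
      proof (cases "j = m")
        case True
        then show ?thesis using Pj by simp
      next
        case False
        then have "j < m"
          using j(2) b by auto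
        then have "j + 1 \<le> m"
          using discrete[of "m - j"] diff m(1) j(1) by simp
        moreover have "c \<notin> B" if "c \<in> {j + 1..m}" for c
        proof
          assume "c \<in> B"
          moreover have "j + 1 \<le> c" "c \<le> m"
            using that by auto
          moreover have "0 \<le> c"
            using \<open>j + 1 \<le> c\<close> \<open>0 < j + 1\<close> by simp
          ultimately have "c \<le> b"
            by (intro b_max) auto
          then show False
            using \<open>j + 1 \<le> c\<close> j(3) by simp
        qed
        then have "{j + 1..m} \<inter> B = {}" by blast
        moreover have "P (j + 1)"
          using step Pj j(1) j0 by (simp add: nonneg_part_def)
        ultimately show ?thesis
          using B(2)[of "j + 1" m] by simp
      qed
    qed
  qed
qed


section \<open>Functions defined by terms\<close>

primrec rename_vars :: "(nat \<Rightarrow> nat) \<Rightarrow> or_term \<Rightarrow> or_term" where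
  "rename_vars r (OVar n) = OVar (r n)"
| "rename_vars r OZero = OZero"
| "rename_vars r OOne = OOne"
| "rename_vars r (OAdd s t) = OAdd (rename_vars r s) (rename_vars r t)"
| "rename_vars r (OMul s t) = OMul (rename_vars r s) (rename_vars r t)"
| "rename_vars r (OExp t) = OExp (rename_vars r t)"

lemma or_eval_rename_vars: "or_eval E e (rename_vars r t) = or_eval E (e \<circ> r) t"
  by (induction t) auto

text \<open>Two term functions come with two parameter assignments, while their sum or product has
  to be one term under one assignment.\<close>

lemma or_eval_merge:
  obtains s' t' e where
    "\<And>z. or_eval E (e(0 := z)) s' = or_eval E (c(0 := z)) s"
    "\<And>z. or_eval E (e(0 := z)) t' = or_eval E (d(0 := z)) t"
proof
  \<comment> \<open>The parameters of \<open>t\<close> occupy the even indices and those of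
    \<open>s\<close> the odd ones; index 0 stays the place of the argument.\<close>
  define e where "e = (\<lambda>n::nat. if even n then d (n div 2) else c (Suc n div 2))"
  let ?r = "\<lambda>n::nat. if n = 0 then 0 else 2 * n - 1"
  have "e(0 := z) \<circ> ?r = c(0 := z)" for z
    by (auto simp: e_def fun_eq_iff)
  then show "or_eval E (e(0 := z)) (rename_vars ?r s) = or_eval E (c(0 := z)) s" for z
    by (simp only: or_eval_rename_vars)
  have "e(0 := z) \<circ> (\<lambda>n. 2 * n) = d(0 := z)" for z
    by (auto simp: e_def fun_eq_iff)
  then show "or_eval E (e(0 := z)) (rename_vars (\<lambda>n. 2 * n) t) = or_eval E (d(0 := z)) t" for z
    by (simp only: or_eval_rename_vars)
qed

text \<open>Every field element enters as a constant, so no assignment has to be carried along.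
  Syntax is recovered by \<open>term_fun_eq_or_eval\<close> when \<open>MaxVal_exp\<close> is
  applied.\<close>

inductive_set term_fun :: "('a::linordered_field \<Rightarrow> 'a) \<Rightarrow> ('a \<Rightarrow> 'a) set"
  for E :: "'a::linordered_field \<Rightarrow> 'a" where
  const: "(\<lambda>_. c) \<in> term_fun E"
| id: "(\<lambda>x. x) \<in> term_fun E"
| add: "f \<in> term_fun E \<Longrightarrow> g \<in> term_fun E \<Longrightarrow> (\<lambda>x. f x + g x) \<in> term_fun E"
| mult: "f \<in> term_fun E \<Longrightarrow> g \<in> term_fun E \<Longrightarrow> (\<lambda>x. f x * g x) \<in> term_fun E"
| exp: "f \<in> term_fun E \<Longrightarrow> (\<lambda>x. E (f x)) \<in> term_fun E"

lemma term_fun_uminus: "f \<in> term_fun E \<Longrightarrow> (\<lambda>x. - f x) \<in> term_fun E"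
  using term_fun.mult[OF term_fun.const[of "- 1"]] by simp

lemma term_fun_diff:
  "f \<in> term_fun E \<Longrightarrow> g \<in> term_fun E \<Longrightarrow> (\<lambda>x. f x - g x) \<in> term_fun E"
  using term_fun.add[OF _ term_fun_uminus] by fastforce

lemma term_fun_eq_or_eval:
  assumes "f \<in> term_fun E"
  shows "\<exists>t e. f = (\<lambda>z. or_eval E (e(0 := z)) t)"
  using assms
proof induction
  case (const c)
  then show ?case
    by (intro exI[of _ "OVar 1"] exI[of _ "\<lambda>_. c"]) simp
next
  case id
  then show ?case
    by (intro exI[of _ "OVar 0"] exI) simp
next
  case (add f g)
  then obtain s t c d where
    "f = (\<lambda>z. or_eval E (c(0 := z)) s)" "g = (\<lambda>z. or_eval E (d(0 := z)) t)"
    by blast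
  moreover obtain s' t' e where "\<And>z. or_eval E (e(0 := z)) s' = or_eval E (c(0 := z)) s"
    "\<And>z. or_eval E (e(0 := z)) t' = or_eval E (d(0 := z)) t"
    using or_eval_merge by metis
  ultimately show ?case
    by (intro exI[of _ "OAdd s' t'"] exI[of _ e]) (simp del: fun_upd_apply)
next
  case (mult f g)
  then obtain s t c d where
    "f = (\<lambda>z. or_eval E (c(0 := z)) s)" "g = (\<lambda>z. or_eval E (d(0 := z)) t)"
    by blast
  moreover obtain s' t' e where "\<And>z. or_eval E (e(0 := z)) s' = or_eval E (c(0 := z)) s"
    "\<And>z. or_eval E (e(0 := z)) t' = or_eval E (d(0 := z)) t"
    using or_eval_merge by metis
  ultimately show ?case
    by (intro exI[of _ "OMul s' t'"] exI[of _ e]) (simp del: fun_upd_apply)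
next
  case (exp f)
  then obtain s c where "f = (\<lambda>z. or_eval E (c(0 := z)) s)"
    by blast
  then show ?case
    by (intro exI[of _ "OExp s"] exI[of _ c]) (simp del: fun_upd_apply)
qed


section \<open>Calculus in exponential fields with MaxVal(exp)\<close>

locale maxval_exp_field =
  fixes E :: "'a::linordered_field \<Rightarrow> 'a"
  assumes exponential_field: "exponential_field E"
    and MaxVal: "MaxVal_exp E"
    and E_1: "E 1 = 2"
begin

lemma E_add: "E (x + y) = E x * E y"
  using exponential_field unfolding exponential_field_def by blast

lemma E_pos: "0 < E x"
proof -
  have "E x \<in> E ` UNIV" by simp
  then show ?thesis
    using exponential_field unfolding exponential_field_def bij_betw_def by auto
qed

lemma E_0: "E 0 = 1"
  using E_add[of 0 0] E_pos[of 0] by simp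

lemma E_minus: "E x * E (- x) = 1"
  using E_add[of x "- x"] E_0 by simp

lemma term_fun_attains_max:
  assumes "f \<in> term_fun E" "a < b"
  obtains z where "a \<le> z" "z \<le> b" "\<And>y. a \<le> y \<Longrightarrow> y \<le> b \<Longrightarrow> f y \<le> f z"
proof -
  obtain t e where f: "f = (\<lambda>z. or_eval E (e(0 := z)) t)"
    using term_fun_eq_or_eval[OF assms(1)] by blast
  obtain z where "z \<in> {a..b}"
    "\<forall>y\<in>{a..b}. or_eval E (e(0 := y)) t \<le> or_eval E (e(0 := z)) t"
    using MaxVal assms(2) unfolding MaxVal_exp_def by blast
  then show thesis
    using that[of z] f by auto
qed

text \<open>At an interior maximum \<open>z\<close> of \<open>x - E x\<close>, the increment
  \<open>E (z + h) - E z\<close> is at least \<open>h\<close>. Division by \<open>E z\<close> moves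
  this bound from \<open>z\<close> to 0, with slope \<open>k = 1 / E z\<close>.\<close>

lemma E_ge_affine:
  obtains k d where "0 < k" "0 < d" "\<And>h. \<bar>h\<bar> < d \<Longrightarrow> 1 + k * h \<le> E h"
proof -
  have "(\<lambda>x. x - E x) \<in> term_fun E"
    by (intro term_fun_diff term_fun.exp term_fun.id)
  then obtain z where z: "0 \<le> z" "z \<le> 1" "\<And>y. 0 \<le> y \<Longrightarrow> y \<le> 1 \<Longrightarrow> y - E y \<le> z - E z"
    using term_fun_attains_max[OF _ zero_less_one] by blast
  \<comment> \<open>\<open>E (1 / 2)\<close> is a square root of 2 and thus below 3/2. So the value
    of \<open>x - E x\<close> at 1/2 exceeds -1, its value at both endpoints.\<close>
  have "E (1 / 2) * E (1 / 2) = 2"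
    using E_add[of "1 / 2" "1 / 2"] E_1 by simp
  moreover have "2 < (3 / 2) * (3 / 2 :: 'a)" by simp
  ultimately have "E (1 / 2) < 3 / 2"
    using mult_mono[of "3 / 2" "E (1 / 2)" "3 / 2" "E (1 / 2)"] E_pos[of "1 / 2"]
    by (simp add: not_less[symmetric]) fastforce
  moreover have "1 / 2 - E (1 / 2) \<le> z - E z"
    by (intro z(3)) auto
  ultimately have "- 1 < z - E z" by simp
  then have "z \<noteq> 0" "z \<noteq> 1"
    using E_0 E_1 by auto
  then have interior: "0 < z" "z < 1"
    using z by auto
  show thesis
  proof
    show "0 < 1 / E z" using E_pos by simp
    show "0 < min z (1 - z)" using interior by simp
    fix h
    assume h: "\<bar>h\<bar> < min z (1 - z)"
    then have "z + h - E (z + h) \<le> z - E z"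
      by (intro z(3)) auto
    then have "h \<le> (E h - 1) * E z"
      by (simp add: E_add algebra_simps)
    then have "h / E z \<le> E h - 1"
      using E_pos[of z] by (simp add: pos_divide_le_eq)
    then show "1 + 1 / E z * h \<le> E h" by simp
  qed
qed

text \<open>The affine bound at \<open>h\<close> and at \<open>- h\<close>, combined through
  \<open>E h * E (- h) = 1\<close>, squeezes \<open>E h - 1\<close> between \<open>k * h\<close> and
  \<open>k * h * E h\<close>. The difference quotient is then within
  \<open>k * \<bar>E h - 1\<bar>\<close> of \<open>k\<close>, which is of order
  \<open>\<bar>h\<bar>\<close>.\<close>

lemma E_has_derivative_0: "\<exists>k. has_derivative_at E k 0"
proof -
  obtain k d where k: "0 < k" and d: "0 < d" and ge: "\<And>h. \<bar>h\<bar> < d \<Longrightarrow> 1 + k * h \<le> E h"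
    using E_ge_affine by blast
  \<comment> \<open>This is the Caratheodory quotient at 0, with the expected derivative filled in
    at \<open>h = 0\<close>.\<close>
  define q where "q = (\<lambda>h. if h = 0 then k else (E h - 1) / h)"
  have close: "\<bar>q h - k\<bar> \<le> 2 * k * k * \<bar>h\<bar>" if h: "\<bar>h\<bar> < min d (1 / (2 * k))" for h
  proof (cases "h = 0")
    case True
    then show ?thesis by (simp add: q_def)
  next
    case False
    have lower: "k * h \<le> E h - 1"
      using ge[of h] h by simp
    have "1 - k * h \<le> E (- h)"
      using ge[of "- h"] h by simp
    then have "E h * (1 - k * h) \<le> 1"
      using mult_left_mono[of "1 - k * h" "E (- h)" "E h"] E_pos[of h] E_minus[of h] by simp
    then have upper: "E h - 1 \<le> k * h * E h"
      by (simp add: algebra_simps)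
    \<comment> \<open>The radius \<open>1 / (2 * k)\<close> was chosen for this:
      \<open>1 - k * h\<close> is at least 1/2, hence \<open>E h\<close> is at most 2.\<close>
    have kh: "k * \<bar>h\<bar> < 1 / 2"
      using h k by (simp add: field_simps)
    then have "k * h \<le> 1 / 2"
      using k by (smt (verit) abs_ge_self less_le mult_left_mono order.trans)
    then have "E h * (1 / 2) \<le> E h * (1 - k * h)"
      using E_pos[of h] by (intro mult_left_mono) auto
    then have E2: "E h \<le> 2"
      using \<open>E h * (1 - k * h) \<le> 1\<close> by simp
    have "\<bar>E h - 1\<bar> \<le> 2 * k * \<bar>h\<bar>"
    proof (cases "0 < h")
      case True
      have "k * h * E h \<le> k * h * 2"
        using True k E2 by (intro mult_left_mono) auto
      moreover have "0 \<le> k * h"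
        using True k by simp
      ultimately show ?thesis
        using lower upper \<open>0 < h\<close> by (simp add: abs_le_iff)
    next
      case h_neg: False
      then have "k * h * E h \<le> 0"
        using k E_pos[of h] by (simp add: mult_le_0_iff)
      moreover have "k * h \<le> 0"
        using h_neg k by (simp add: mult_le_0_iff)
      ultimately show ?thesis
        using h_neg lower upper by (simp add: abs_le_iff)
    qed
    then have small: "k * \<bar>E h - 1\<bar> \<le> 2 * k * k * \<bar>h\<bar>"
      using mult_left_mono[of "\<bar>E h - 1\<bar>" "2 * k * \<bar>h\<bar>" k] k by (simp add: algebra_simps)
    have "q h * h = E h - 1"
      using False by (simp add: q_def)
    then have "(q h - k) * h = E h - 1 - k * h"
      by (simp add: left_diff_distrib)
    then have "\<bar>q h - k\<bar> * \<bar>h\<bar> = \<bar>E h - 1 - k * h\<bar>"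
      by (metis abs_mult)
    \<comment> \<open>By \<open>lower\<close> and \<open>upper\<close>,
      \<open>E h - 1 - k * h\<close> lies between 0 and \<open>k * h * (E h - 1)\<close>.\<close>
    also have "\<dots> \<le> \<bar>k * h * (E h - 1)\<bar>"
      using lower upper by (simp add: algebra_simps)
    also have "\<dots> = k * \<bar>E h - 1\<bar> * \<bar>h\<bar>"
      using k by (simp add: abs_mult)
    finally have "\<bar>q h - k\<bar> \<le> k * \<bar>E h - 1\<bar>"
      using False by simp
    then show ?thesis
      using small by simp
  qed
  have "continuous_at q 0"
    unfolding continuous_at_def
  proof (intro allI impI)
    fix e :: 'a
    assume e: "0 < e"
    define r where "r = min (min d (1 / (2 * k))) (e / (2 * k * k))"
    have "0 < r"
      using d k e by (simp add: r_def)
    moreover have "\<bar>q h - k\<bar> < e" if "\<bar>h\<bar> < r" for h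
    proof -
      have "\<bar>q h - k\<bar> \<le> 2 * k * k * \<bar>h\<bar>"
        using that by (intro close) (simp add: r_def)
      also have "\<dots> < e"
        using that k by (simp add: r_def field_simps)
      finally show ?thesis .
    qed
    moreover have "q 0 = k"
      by (simp add: q_def)
    ultimately show "\<exists>d>0. \<forall>y. \<bar>y - 0\<bar> < d \<longrightarrow> \<bar>q y - q 0\<bar> < e"
      by (intro exI[of _ r]) simp
  qed
  moreover have "E y = E 0 + q y * (y - 0)" for y
    by (simp add: q_def E_0)
  ultimately have "has_derivative_at E (q 0) 0"
    unfolding has_derivative_at_def by blast
  then show ?thesis by blast
qed

text \<open>The identity \<open>E y = E x * E (y - x)\<close> carries the derivative from 0 to
  \<open>x\<close>.\<close>

lemma E_has_derivative: "\<exists>k. \<forall>x. has_derivative_at E (k * E x) x"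
proof -
  obtain k where k: "has_derivative_at E k 0"
    using E_has_derivative_0 by blast
  have "has_derivative_at E (k * E x) x" for x
  proof -
    have "has_derivative_at (\<lambda>y. y + - x) (1 + 0) x"
      by (intro has_derivative_at_add has_derivative_at_id has_derivative_at_const)
    then have "has_derivative_at (\<lambda>y. E (y + - x)) (k * (1 + 0)) x"
      using k by (intro has_derivative_at_compose) auto
    then have "has_derivative_at (\<lambda>y. E x * E (y + - x)) (E x * k) x"
      using has_derivative_at_mult[OF has_derivative_at_const[of "E x"]] by fastforce
    moreover have "(\<lambda>y. E x * E (y + - x)) = E"
      by (simp add: E_add[symmetric])
    ultimately show ?thesis
      by (simp add: mult.commute)
  qed
  then show ?thesis by blast
qed

text \<open>Over the reals \<open>E\<close> is the power function with base 2, and this constant is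
  the natural logarithm of 2.\<close>

definition deriv_factor :: 'a where
  "deriv_factor = (SOME k. \<forall>x. has_derivative_at E (k * E x) x)"

lemma has_derivative_at_E: "has_derivative_at E (deriv_factor * E x) x"
  using someI_ex[OF E_has_derivative] unfolding deriv_factor_def by (rule spec)

section \<open>Rolle's theorem, the mean value theorem and signs of term functions\<close>

definition is_deriv :: "('a \<Rightarrow> 'a) \<Rightarrow> ('a \<Rightarrow> 'a) \<Rightarrow> bool" where
  "is_deriv f f' \<longleftrightarrow> (\<forall>x. has_derivative_at f (f' x) x)"

lemma is_deriv_const: "is_deriv (\<lambda>_. c) (\<lambda>_. 0)"
  by (simp add: is_deriv_def has_derivative_at_const)

lemma is_deriv_id: "is_deriv (\<lambda>x. x) (\<lambda>_. 1)"
  by (simp add: is_deriv_def has_derivative_at_id)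

lemma is_deriv_add:
  "is_deriv f f' \<Longrightarrow> is_deriv g g' \<Longrightarrow> is_deriv (\<lambda>x. f x + g x) (\<lambda>x. f' x + g' x)"
  unfolding is_deriv_def by (intro allI has_derivative_at_add) auto

lemma is_deriv_uminus: "is_deriv f f' \<Longrightarrow> is_deriv (\<lambda>x. - f x) (\<lambda>x. - f' x)"
  by (simp add: is_deriv_def has_derivative_at_uminus)

lemma is_deriv_mult:
  "is_deriv f f' \<Longrightarrow> is_deriv g g' \<Longrightarrow> is_deriv (\<lambda>x. f x * g x) (\<lambda>x. f' x * g x + f x * g' x)"
  unfolding is_deriv_def by (intro allI has_derivative_at_mult) auto

lemma is_deriv_exp:
  "is_deriv f f' \<Longrightarrow> is_deriv (\<lambda>x. E (f x)) (\<lambda>x. deriv_factor * E (f x) * f' x)"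
  unfolding is_deriv_def using has_derivative_at_compose[OF _ has_derivative_at_E] by blast

text \<open>Maximum and minimum are attained, the latter as a maximum of \<open>- f\<close>. Either
  one of them is interior, or both equal the common endpoint value and \<open>f\<close> is constant
  on the interval.\<close>

lemma rolle:
  assumes f: "f \<in> term_fun E" "is_deriv f f'" and "a < b" and eq: "f a = f b"
  obtains z where "a < z" "z < b" "f' z = 0"
proof -
  obtain u where u: "a \<le> u" "u \<le> b" "\<And>y. a \<le> y \<Longrightarrow> y \<le> b \<Longrightarrow> f y \<le> f u"
    using term_fun_attains_max[OF f(1) \<open>a < b\<close>] by blast
  obtain v where v: "a \<le> v" "v \<le> b" "\<And>y. a \<le> y \<Longrightarrow> y \<le> b \<Longrightarrow> - f y \<le> - f v"
    using term_fun_attains_max[OF term_fun_uminus[OF f(1)] \<open>a < b\<close>] by blast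
  have der: "has_derivative_at f (f' z) z" for z
    using f(2) unfolding is_deriv_def by blast
  consider "a < u" "u < b" | "a < v" "v < b" | "f u = f a" "f v = f a"
    using u(1,2) v(1,2) eq by fastforce
  then show thesis
  proof cases
    case 1
    then have "f' u = 0"
      using u(3) by (intro has_derivative_at_local_max[OF der]) auto
    then show ?thesis using that 1 by blast
  next
    case 2
    then have "- f' v = 0"
      using v(3) by (intro has_derivative_at_local_max[OF has_derivative_at_uminus[OF der]]) auto
    then show ?thesis using that 2 by simp
  next
    case 3
    have const: "f y = f a" if "a \<le> y" "y \<le> b" for y
      using u(3)[OF that] v(3)[OF that] 3 by simp
    obtain z where z: "a < z" "z < b"
      using dense[OF \<open>a < b\<close>] by blast
    have "f' z = 0"
    proof (rule has_derivative_at_local_max[OF der z])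
      show "f y \<le> f z" if "a < y" "y < b" for y
        using const[of y] const[of z] z that by simp
    qed
    then show ?thesis using that z by blast
  qed
qed

lemma mean_value:
  assumes f: "f \<in> term_fun E" "is_deriv f f'" and "a < b"
  obtains z where "a < z" "z < b" "f b - f a = f' z * (b - a)"
proof -
  \<comment> \<open>Subtracting the chord slope times \<open>x\<close> stays among the term
    functions, since the slope is a parameter.\<close>
  define c where "c = (f b - f a) / (b - a)"
  have c: "c * (b - a) = f b - f a"
    using \<open>a < b\<close> by (simp add: c_def)
  have "(\<lambda>x. f x + - c * x) \<in> term_fun E"
    by (intro term_fun.intros f(1))
  moreover have "is_deriv (\<lambda>x. f x + - c * x) (\<lambda>x. f' x + (0 * x + - c * 1))"
    by (intro is_deriv_add is_deriv_mult is_deriv_const is_deriv_id f(2))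
  moreover have "f a + - c * a = f b + - c * b"
    using c by (simp add: algebra_simps)
  ultimately obtain z where "a < z" "z < b" "f' z + (0 * z + - c * 1) = 0"
    using rolle[OF _ _ \<open>a < b\<close>] by blast
  then show thesis
    using that[of z] c by simp
qed

text \<open>The general intermediate value theorem would need antiderivatives. Where \<open>f'\<close> has no zero,
  a maximum point of \<open>-f\<^sup>2\<close> is a zero of \<open>f\<close>.\<close>

lemma zero_of_sign_change:
  assumes f: "f \<in> term_fun E" "is_deriv f f'" and "a < b"
    and sign: "f a < 0" "0 < f b"
    and nz: "\<And>z. a \<le> z \<Longrightarrow> z \<le> b \<Longrightarrow> sgn (f' z) = s" and "s \<noteq> 0"
  obtains z where "a \<le> z" "z \<le> b" "f z = 0"
proof -
  \<comment> \<open>\<open>f\<close> increases from \<open>a\<close> to \<open>b\<close>, so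
    \<open>f'\<close> is positive somewhere; as its sign is constant, it is positive
    throughout.\<close>
  obtain w where w: "a < w" "w < b" "f b - f a = f' w * (b - a)"
    using mean_value[OF f \<open>a < b\<close>] by blast
  have "0 < f' w * (b - a)"
    using sign w(3) by linarith
  then have "0 < f' w"
    using \<open>a < b\<close> by (simp add: zero_less_mult_iff)
  then have "s = 1"
    using nz[of w] w by simp
  then have pos: "0 < f' z" if "a \<le> z" "z \<le> b" for z
    using nz[OF that] by (simp add: sgn_1_pos)
  define g where "g = (\<lambda>x. - (f x * f x))"
  have g: "g \<in> term_fun E"
    unfolding g_def by (intro term_fun_uminus term_fun.mult f(1))
  obtain z where z: "a \<le> z" "z \<le> b" "\<And>y. a \<le> y \<Longrightarrow> y \<le> b \<Longrightarrow> g y \<le> g z"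
    using term_fun_attains_max[OF g \<open>a < b\<close>] by blast
  have "has_derivative_at g (- (f' z * f z + f z * f' z)) z"
    unfolding g_def using f(2)
    by (intro has_derivative_at_uminus has_derivative_at_mult) (auto simp: is_deriv_def)
  then have der: "has_derivative_at g (- 2 * (f' z * f z)) z"
    by (simp add: mult.commute)
  have "0 \<le> f' z * f z" if "z < b"
    using has_derivative_at_right_max[OF der that] z by (simp add: mult.commute)
  then have right: "0 \<le> f z"
    using pos[OF z(1,2)] z(2) sign(2) by (cases "z = b") (auto simp: zero_le_mult_iff)
  have "f' z * f z \<le> 0" if "a < z"
    using has_derivative_at_left_max[OF der that] z by (simp add: mult.commute)
  then have "f z \<le> 0"
    using pos[OF z(1,2)] z(1) sign(1) by (cases "z = a") (auto simp: mult_le_0_iff)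
  then show thesis
    using that[OF z(1,2)] right by simp
qed

lemma sgn_const_without_zeros:
  assumes f: "f \<in> term_fun E" "is_deriv f f'" and "a < b"
    and nz: "\<And>z. a \<le> z \<Longrightarrow> z \<le> b \<Longrightarrow> sgn (f' z) = s" and "s \<noteq> 0"
    and no_zero: "\<And>z. a \<le> z \<Longrightarrow> z \<le> b \<Longrightarrow> f z \<noteq> 0"
  shows "sgn (f a) = sgn (f b)"
proof (rule ccontr)
  assume "sgn (f a) \<noteq> sgn (f b)"
  moreover have "f a \<noteq> 0" "f b \<noteq> 0"
    using no_zero \<open>a < b\<close> by auto
  ultimately consider "f a < 0" "0 < f b" | "- f a < 0" "0 < - f b"
    by (auto simp: sgn_if split: if_splits)
  then show False
  proof cases
    case 1
    then show ?thesis
      using zero_of_sign_change[OF f \<open>a < b\<close> 1 nz \<open>s \<noteq> 0\<close>] no_zero by blast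
  next
    case 2
    have "sgn (- f' z) = - s" if "a \<le> z" "z \<le> b" for z
      using nz[OF that] by (simp add: sgn_minus)
    then obtain z where "a \<le> z" "z \<le> b" "- f z = 0"
      using zero_of_sign_change[OF term_fun_uminus[OF f(1)] is_deriv_uminus[OF f(2)] \<open>a < b\<close> 2,
          of "- s"] \<open>s \<noteq> 0\<close> by auto
    then show ?thesis using no_zero by auto
  qed
qed

text \<open>The new break points are the zeros of \<open>f\<close> outside \<open>B\<close> at which
  \<open>f'\<close> does not vanish. By Rolle's theorem each piece of \<open>f'\<close> contains at
  most one of them. Zeros with \<open>f' = 0\<close> can be left out: there \<open>f'\<close>
  vanishes on the whole piece, and \<open>f\<close> is constant on it by the mean value
  theorem.\<close>

lemma piecewise_const_sgn_of_deriv: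
  assumes f: "f \<in> term_fun E" "is_deriv f f'"
    and f': "piecewise_const (\<lambda>x. sgn (f' x))"
  shows "piecewise_const (\<lambda>x. sgn (f x))"
proof -
  obtain B where B: "finite B" "\<And>x y. x \<le> y \<Longrightarrow> {x..y} \<inter> B = {} \<Longrightarrow> sgn (f' x) = sgn (f' y)"
    using f' unfolding piecewise_const_def by blast
  have sgn_f': "sgn (f' z) = sgn (f' x)" if "{x..y} \<inter> B = {}" "x \<le> z" "z \<le> y" for x y z
    using that by (intro B(2)[symmetric]) fastforce+
  define Z where "Z = {z. z \<notin> B \<and> f z = 0 \<and> f' z \<noteq> 0}"
  have no_two: False
    if "x < y" "{b \<in> B. b < x} = {b \<in> B. b < y}" "x \<in> Z" "y \<in> Z" for x y
  proof -
    have disj: "{x..y} \<inter> B = {}"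
    proof (rule ccontr)
      assume "{x..y} \<inter> B \<noteq> {}"
      then obtain b where "b \<in> B" "x \<le> b" "b \<le> y" by auto
      moreover from this have "b \<noteq> x" "b \<noteq> y"
        using that(3,4) by (auto simp: Z_def)
      ultimately have "b \<in> {b \<in> B. b < y}" "b \<notin> {b \<in> B. b < x}"
        by auto
      then show False
        using that(2) by blast
    qed
    have "f x = f y"
      using that(3,4) by (simp add: Z_def)
    then obtain z where z: "x < z" "z < y" "f' z = 0"
      using rolle[OF f \<open>x < y\<close>] by blast
    then have "f' x = 0"
      using sgn_f'[OF disj, of z] by (simp add: sgn_0_0)
    then show False
      using that(3) by (simp add: Z_def)
  qed
  \<comment> \<open>By \<open>no_two\<close>, a point of \<open>Z\<close> is determined by the break
    points below it, so \<open>Z\<close> embeds into the power set of \<open>B\<close>.\<close>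
  have "inj_on (\<lambda>z. {b \<in> B. b < z}) Z"
    using no_two by (intro inj_onI) (metis linorder_neqE)
  moreover have "finite ((\<lambda>z. {b \<in> B. b < z}) ` Z)"
    by (rule finite_subset[of _ "Pow B"]) (use B(1) in auto)
  ultimately have "finite Z"
    using finite_imageD by blast
  show ?thesis
  proof (rule piecewise_constI[of "B \<union> Z"])
    show "finite (B \<union> Z)"
      using B(1) \<open>finite Z\<close> by simp
    fix x y
    assume "x \<le> y" and disj: "{x..y} \<inter> (B \<union> Z) = {}"
    then have disj_B: "{x..y} \<inter> B = {}" by auto
    show "sgn (f x) = sgn (f y)"
    proof (cases "x = y")
      case False
      then have "x < y"
        using \<open>x \<le> y\<close> by simp
      show ?thesis
      proof (cases "f' x = 0")
        case True
        obtain z where z: "x < z" "z < y" "f y - f x = f' z * (y - x)"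
          using mean_value[OF f \<open>x < y\<close>] by blast
        have "f' z = 0"
          using sgn_f'[OF disj_B, of z] z True by (simp add: sgn_0_0)
        then show ?thesis using z by simp
      next
        case False
        have "f z \<noteq> 0" if "x \<le> z" "z \<le> y" for z
        proof
          assume "f z = 0"
          moreover have "f' z \<noteq> 0"
            using sgn_f'[OF disj_B that] False by (metis sgn_0_0)
          ultimately show False
            using disj that by (auto simp: Z_def)
        qed
        then show ?thesis
          using sgn_const_without_zeros[OF f \<open>x < y\<close> sgn_f'[OF disj_B]] False
          by (simp add: sgn_0_0)
      qed
    qed simp
  qed
qed


section \<open>Reduction of term functions to zero\<close>

text \<open>The exponents are restricted to \<open>A\<close> so that, in \<open>reducible_add\<close>, the summand \<open>s\<close> stays a sum
  of the same number of exponentials throughout the reduction of \<open>a\<close>.\<close>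

inductive reducible :: "('a \<Rightarrow> 'a) set \<Rightarrow> ('a \<Rightarrow> 'a) \<Rightarrow> bool" for A where
  zero: "reducible A (\<lambda>_. 0)"
| deriv: "f \<in> term_fun E \<Longrightarrow> is_deriv f f' \<Longrightarrow> reducible A f' \<Longrightarrow> reducible A f"
| exp_mult: "h \<in> A \<Longrightarrow> reducible A (\<lambda>x. E (h x) * f x) \<Longrightarrow> reducible A f"

text \<open>A reduction is read backwards: a differentiation is undone by
  \<open>piecewise_const_sgn_of_deriv\<close>, and a positive factor does not affect signs.\<close>

lemma reducible_piecewise_const_sgn:
  "reducible A f \<Longrightarrow> piecewise_const (\<lambda>x. sgn (f x))"
proof (induction rule: reducible.induct)
  case zero
  show ?case by (auto intro: piecewise_constI[of "{}"])
next
  case (deriv f f')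
  then show ?case using piecewise_const_sgn_of_deriv by blast
next
  case (exp_mult h f)
  then show ?case using E_pos by (simp add: sgn_mult)
qed

section \<open>Differential rings and polynomial functions\<close>

definition differential_ring :: "('a \<Rightarrow> 'a) set \<Rightarrow> bool" where
  "differential_ring A \<longleftrightarrow> A \<subseteq> term_fun E \<and> (\<forall>c. (\<lambda>_. c) \<in> A) \<and>
     (\<forall>f\<in>A. \<forall>g\<in>A. (\<lambda>x. f x + g x) \<in> A) \<and> (\<forall>f\<in>A. \<forall>g\<in>A. (\<lambda>x. f x * g x) \<in> A) \<and>
     (\<forall>f\<in>A. \<exists>f'\<in>A. is_deriv f f')"

lemma
  assumes "differential_ring A"
  shows differential_ring_subset: "f \<in> A \<Longrightarrow> f \<in> term_fun E"
    and differential_ring_const: "(\<lambda>_. c) \<in> A"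
    and differential_ring_add: "f \<in> A \<Longrightarrow> g \<in> A \<Longrightarrow> (\<lambda>x. f x + g x) \<in> A"
    and differential_ring_mult: "f \<in> A \<Longrightarrow> g \<in> A \<Longrightarrow> (\<lambda>x. f x * g x) \<in> A"
    and differential_ring_deriv: "f \<in> A \<Longrightarrow> \<exists>f'\<in>A. is_deriv f f'"
  using assms unfolding differential_ring_def by auto

lemma differential_ring_uminus:
  assumes "differential_ring A" "f \<in> A"
  shows "(\<lambda>x. - f x) \<in> A"
  using differential_ring_mult[OF assms(1) differential_ring_const[OF assms(1), of "- 1"] assms(2)]
  by simp

text \<open>These are the polynomial functions of degree below \<open>d\<close>, described as the
  term functions that \<open>d\<close> differentiations turn into 0. In this form their reducibility
  is immediate.\<close>

primrec poly_fun :: "nat \<Rightarrow> ('a \<Rightarrow> 'a) set" where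
  "poly_fun 0 = {\<lambda>_. 0}"
| "poly_fun (Suc d) = {f \<in> term_fun E. \<exists>f'\<in>poly_fun d. is_deriv f f'}"

lemma poly_fun_term_fun: "f \<in> poly_fun d \<Longrightarrow> f \<in> term_fun E"
  by (cases d) (auto intro: term_fun.const)

lemma zero_poly_fun: "(\<lambda>_. 0) \<in> poly_fun d"
  by (induction d) (auto intro: term_fun.const is_deriv_const)

lemma const_poly_fun: "(\<lambda>_. c) \<in> poly_fun (Suc d)"
  using zero_poly_fun by (auto intro: term_fun.const is_deriv_const)

lemma poly_fun_Suc: "f \<in> poly_fun d \<Longrightarrow> f \<in> poly_fun (Suc d)"
proof (induction d arbitrary: f)
  case 0
  then show ?case by (auto intro: term_fun.const is_deriv_const)
next
  case (Suc d)
  from Suc.prems obtain f' where "f \<in> term_fun E" "f' \<in> poly_fun d" "is_deriv f f'"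
    by auto
  moreover from this have "f' \<in> poly_fun (Suc d)"
    using Suc.IH by blast
  ultimately show ?case
    unfolding poly_fun.simps(2)[of "Suc d"] by blast
qed

lemma poly_fun_mono: "m \<le> n \<Longrightarrow> f \<in> poly_fun m \<Longrightarrow> f \<in> poly_fun n"
  by (induction rule: dec_induct) (auto simp del: poly_fun.simps intro: poly_fun_Suc)

lemma poly_fun_add:
  "f \<in> poly_fun d \<Longrightarrow> g \<in> poly_fun d \<Longrightarrow> (\<lambda>x. f x + g x) \<in> poly_fun d"
proof (induction d arbitrary: f g)
  case (Suc d)
  then obtain f' g' where "f' \<in> poly_fun d" "g' \<in> poly_fun d" "is_deriv f f'" "is_deriv g g'"
    by auto
  then have "(\<lambda>x. f' x + g' x) \<in> poly_fun d" "is_deriv (\<lambda>x. f x + g x) (\<lambda>x. f' x + g' x)"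
    using Suc.IH by (auto intro: is_deriv_add)
  then show ?case
    using Suc.prems by (auto intro: term_fun.add)
qed simp

text \<open>Induction on \<open>m + n\<close> with the Leibniz rule: each of the two products in the
  derivative lowers one of the indices by one.\<close>

lemma poly_fun_mult:
  "f \<in> poly_fun m \<Longrightarrow> g \<in> poly_fun n \<Longrightarrow> (\<lambda>x. f x * g x) \<in> poly_fun (m + n)"
proof (induction "m + n" arbitrary: f g m n)
  case 0
  then show ?case by simp
next
  case (Suc d)
  show ?case
  proof (cases "m = 0 \<or> n = 0")
    case True
    then have "(\<lambda>x. f x * g x) = (\<lambda>_. 0)"
      using Suc.prems by auto
    then show ?thesis using zero_poly_fun by simp
  next
    case False
    then obtain m' n' where mn: "m = Suc m'" "n = Suc n'"
      using not0_implies_Suc by blast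
    obtain f' g' where fg: "f' \<in> poly_fun m'" "g' \<in> poly_fun n'" "is_deriv f f'" "is_deriv g g'"
      using Suc.prems mn by auto
    have "(\<lambda>x. f' x * g x) \<in> poly_fun (m' + n)"
      using Suc.hyps(2) fg(1) Suc.prems(2) mn by (intro Suc.hyps(1)) simp_all
    moreover have "(\<lambda>x. f x * g' x) \<in> poly_fun (m + n')"
      using Suc.hyps(2) fg(2) Suc.prems(1) mn by (intro Suc.hyps(1)) simp_all
    ultimately have "(\<lambda>x. f' x * g x + f x * g' x) \<in> poly_fun (Suc (m' + n'))"
      using mn by (intro poly_fun_add) (simp_all del: poly_fun.simps)
    moreover have "is_deriv (\<lambda>x. f x * g x) (\<lambda>x. f' x * g x + f x * g' x)"
      using fg by (intro is_deriv_mult)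
    moreover have "(\<lambda>x. f x * g x) \<in> term_fun E"
      using Suc.prems by (intro term_fun.mult poly_fun_term_fun)
    moreover have "m + n = Suc (Suc (m' + n'))"
      using mn by simp
    ultimately show ?thesis
      unfolding poly_fun.simps(2)[of "Suc (m' + n')"] \<open>m + n = Suc (Suc (m' + n'))\<close> by blast
  qed
qed

lemma reducible_poly_fun: "f \<in> poly_fun d \<Longrightarrow> reducible A f"
  by (induction d arbitrary: f) (auto intro: reducible.intros)

lemma differential_ring_poly_fun: "differential_ring (\<Union>d. poly_fun d)"
  unfolding differential_ring_def
proof (intro conjI allI ballI)
  show "(\<Union>d. poly_fun d) \<subseteq> term_fun E"
    using poly_fun_term_fun by blast
  show "(\<lambda>_. c) \<in> (\<Union>d. poly_fun d)" for c
    using const_poly_fun by blast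
next
  fix f g
  assume "f \<in> (\<Union>d. poly_fun d)" "g \<in> (\<Union>d. poly_fun d)"
  then obtain m n where mn: "f \<in> poly_fun m" "g \<in> poly_fun n" by blast
  then have "f \<in> poly_fun (max m n)" "g \<in> poly_fun (max m n)"
    by (auto intro: poly_fun_mono[rotated])
  then show "(\<lambda>x. f x + g x) \<in> (\<Union>d. poly_fun d)"
    using poly_fun_add by blast
  show "(\<lambda>x. f x * g x) \<in> (\<Union>d. poly_fun d)"
    using poly_fun_mult[OF mn] by blast
next
  fix f
  assume "f \<in> (\<Union>d. poly_fun d)"
  then obtain d where "f \<in> poly_fun (Suc d)"
    using poly_fun_Suc by blast
  then show "\<exists>f'\<in>\<Union>d. poly_fun d. is_deriv f f'" by auto
qed

section \<open>Exponential sums over a differential ring\<close>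

primrec exp_sum :: "('a \<Rightarrow> 'a) set \<Rightarrow> nat \<Rightarrow> ('a \<Rightarrow> 'a) set" where
  "exp_sum A 0 = {\<lambda>_. 0}"
| "exp_sum A (Suc k) =
     {f. \<exists>s\<in>exp_sum A k. \<exists>a\<in>A. \<exists>g\<in>A. f = (\<lambda>x. s x + a x * E (g x))}"

lemma exp_sum_SucI:
  "s \<in> exp_sum A k \<Longrightarrow> a \<in> A \<Longrightarrow> g \<in> A \<Longrightarrow> (\<lambda>x. s x + a x * E (g x)) \<in> exp_sum A (Suc k)"
  by auto

lemma exp_sum_SucE:
  assumes "f \<in> exp_sum A (Suc k)"
  obtains s a g where "s \<in> exp_sum A k" "a \<in> A" "g \<in> A" "f = (\<lambda>x. s x + a x * E (g x))"
  using assms by auto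

declare exp_sum.simps(2) [simp del]

context
  fixes A
  assumes A: "differential_ring A"
begin

lemma exp_sum_term_fun: "f \<in> exp_sum A k \<Longrightarrow> f \<in> term_fun E"
proof (induction k arbitrary: f)
  case 0
  then show ?case by (simp add: term_fun.const)
next
  case (Suc k)
  from Suc.prems obtain s a g where s: "s \<in> exp_sum A k" and ag: "a \<in> A" "g \<in> A"
    and f: "f = (\<lambda>x. s x + a x * E (g x))"
    by (rule exp_sum_SucE)
  show ?case
    unfolding f using Suc.IH[OF s] ag
    by (intro term_fun.add term_fun.mult term_fun.exp) (auto intro: differential_ring_subset[OF A])
qed

text \<open>Multiplication acts on each summand separately, by adding exponents and multiplying
  coefficients, so the number \<open>k\<close> of summands is kept.\<close>

lemma exp_sum_mult_monomial:
  assumes "a \<in> A" "g \<in> A"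
  shows "f \<in> exp_sum A k \<Longrightarrow> (\<lambda>x. f x * (a x * E (g x))) \<in> exp_sum A k"
proof (induction k arbitrary: f)
  case (Suc k)
  from Suc.prems obtain s b h where s: "s \<in> exp_sum A k" and bh: "b \<in> A" "h \<in> A"
    and f: "f = (\<lambda>x. s x + b x * E (h x))"
    by (rule exp_sum_SucE)
  have "(\<lambda>x. s x * (a x * E (g x)) + (b x * a x) * E (h x + g x)) \<in> exp_sum A (Suc k)"
    using bh assms Suc.IH[OF s]
    by (intro exp_sum_SucI differential_ring_add[OF A] differential_ring_mult[OF A])
  then show ?case
    by (simp add: f E_add algebra_simps)
qed simp

lemma exp_sum_mult:
  assumes "a \<in> A" "f \<in> exp_sum A k"
  shows "(\<lambda>x. a x * f x) \<in> exp_sum A k"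
  using exp_sum_mult_monomial[OF assms(1) differential_ring_const[OF A, of 0] assms(2)]
  by (simp add: E_0 mult.commute)

lemma exp_sum_mult_exp:
  assumes "g \<in> A" "f \<in> exp_sum A k"
  shows "(\<lambda>x. E (g x) * f x) \<in> exp_sum A k"
  using exp_sum_mult_monomial[OF differential_ring_const[OF A, of 1] assms]
  by (simp add: mult.commute)

text \<open>The derivative of \<open>a * E g\<close> is
  \<open>(a' + deriv_factor * a * g') * E g\<close>, again a single summand with the same exponent.
  Differentiation therefore keeps \<open>k\<close>.\<close>

lemma exp_sum_deriv: "f \<in> exp_sum A k \<Longrightarrow> \<exists>f'\<in>exp_sum A k. is_deriv f f'"
proof (induction k arbitrary: f)
  case 0
  then show ?case by (auto intro: is_deriv_const)
next
  case (Suc k)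
  from Suc.prems obtain s a g where s: "s \<in> exp_sum A k" and ag: "a \<in> A" "g \<in> A"
    and f: "f = (\<lambda>x. s x + a x * E (g x))"
    by (rule exp_sum_SucE)
  obtain s' a' g' where s': "s' \<in> exp_sum A k" "is_deriv s s'"
    and a': "a' \<in> A" "is_deriv a a'" and g': "g' \<in> A" "is_deriv g g'"
    using Suc.IH[OF s] differential_ring_deriv[OF A] ag by metis
  have "is_deriv f (\<lambda>x. s' x + (a' x * E (g x) + a x * (deriv_factor * E (g x) * g' x)))"
    unfolding f by (intro is_deriv_add is_deriv_mult is_deriv_exp s' a' g')
  also have "(\<lambda>x. s' x + (a' x * E (g x) + a x * (deriv_factor * E (g x) * g' x))) =
      (\<lambda>x. s' x + (a' x + deriv_factor * (a x * g' x)) * E (g x))"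
    by (simp add: algebra_simps)
  finally show ?case
    using s' a' g' ag
    by (intro bexI[of _ "\<lambda>x. s' x + (a' x + deriv_factor * (a x * g' x)) * E (g x)"] exp_sum_SucI
        differential_ring_add[OF A] differential_ring_mult[OF A] differential_ring_const[OF A])
qed

lemma exp_sum_add:
  "f \<in> exp_sum A k \<Longrightarrow> g \<in> exp_sum A l \<Longrightarrow> (\<lambda>x. f x + g x) \<in> exp_sum A (k + l)"
proof (induction k arbitrary: f)
  case (Suc k)
  from Suc.prems(1) obtain s a h where s: "s \<in> exp_sum A k" and ah: "a \<in> A" "h \<in> A"
    and f: "f = (\<lambda>x. s x + a x * E (h x))"
    by (rule exp_sum_SucE)
  show ?case
    using exp_sum_SucI[OF Suc.IH[OF s Suc.prems(2)] ah] by (simp add: f algebra_simps)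
qed simp

lemma exp_sum_prod:
  "f \<in> exp_sum A k \<Longrightarrow> g \<in> exp_sum A l \<Longrightarrow> (\<lambda>x. f x * g x) \<in> exp_sum A (k * l)"
proof (induction k arbitrary: f)
  case (Suc k)
  from Suc.prems(1) obtain s a h where s: "s \<in> exp_sum A k" and ah: "a \<in> A" "h \<in> A"
    and f: "f = (\<lambda>x. s x + a x * E (h x))"
    by (rule exp_sum_SucE)
  show ?case
    using exp_sum_add[OF exp_sum_mult_monomial[OF ah Suc.prems(2)] Suc.IH[OF s Suc.prems(2)]]
    by (simp add: f algebra_simps)
qed simp

lemma monomial_exp_sum:
  assumes "a \<in> A" "g \<in> A"
  shows "(\<lambda>x. a x * E (g x)) \<in> exp_sum A 1"
  using exp_sum_SucI[of "\<lambda>_. 0" A 0] assms by simp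

lemma subset_exp_sum:
  assumes "a \<in> A"
  shows "a \<in> exp_sum A 1"
  using monomial_exp_sum[OF assms differential_ring_const[OF A, of 0]] by (simp add: E_0)

lemma exp_exp_sum:
  assumes "g \<in> A"
  shows "(\<lambda>x. E (g x)) \<in> exp_sum A 1"
  using monomial_exp_sum[OF differential_ring_const[OF A, of 1] assms] by simp

lemma differential_ring_exp_sum: "differential_ring (\<Union>k. exp_sum A k)"
  unfolding differential_ring_def
proof (intro conjI allI ballI)
  show "(\<Union>k. exp_sum A k) \<subseteq> term_fun E"
    using exp_sum_term_fun by blast
  show "(\<lambda>_. c) \<in> (\<Union>k. exp_sum A k)" for c
    using subset_exp_sum[OF differential_ring_const[OF A]] by blast
next
  fix f g
  assume "f \<in> (\<Union>k. exp_sum A k)" "g \<in> (\<Union>k. exp_sum A k)"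
  then obtain k l where kl: "f \<in> exp_sum A k" "g \<in> exp_sum A l" by blast
  show "(\<lambda>x. f x + g x) \<in> (\<Union>k. exp_sum A k)"
    using exp_sum_add[OF kl] by blast
  show "(\<lambda>x. f x * g x) \<in> (\<Union>k. exp_sum A k)"
    using exp_sum_prod[OF kl] by blast
next
  fix f
  assume "f \<in> (\<Union>k. exp_sum A k)"
  then show "\<exists>f'\<in>\<Union>k. exp_sum A k. is_deriv f f'"
    using exp_sum_deriv by blast
qed

text \<open>The reduction of \<open>a\<close> is replayed on \<open>a + s\<close>. A differentiation
  keeps \<open>s\<close> in \<open>exp_sum A k\<close>, and so does a factor \<open>E h\<close> with
  \<open>h\<close> in \<open>B\<close>, because \<open>E h\<close> is a coefficient from
  \<open>A\<close>. Once \<open>a\<close> has become 0, \<open>sums\<close> finishes the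
  reduction.\<close>

lemma reducible_add:
  assumes "B \<subseteq> A" and exp: "\<And>h. h \<in> B \<Longrightarrow> (\<lambda>x. E (h x)) \<in> A"
    and sums: "\<And>s. s \<in> exp_sum A k \<Longrightarrow> reducible A s"
    and "reducible B a" "s \<in> exp_sum A k"
  shows "reducible A (\<lambda>x. a x + s x)"
  using assms(4,5)
proof (induction arbitrary: s rule: reducible.induct)
  case zero
  then show ?case using sums by simp
next
  case (deriv a a')
  obtain s' where s': "s' \<in> exp_sum A k" "is_deriv s s'"
    using exp_sum_deriv[OF deriv.prems] by blast
  show ?case
  proof (rule reducible.deriv)
    show "(\<lambda>x. a x + s x) \<in> term_fun E"
      using deriv.hyps(1) exp_sum_term_fun[OF deriv.prems] by (rule term_fun.add)
    show "is_deriv (\<lambda>x. a x + s x) (\<lambda>x. a' x + s' x)"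
      using deriv.hyps(2) s'(2) by (rule is_deriv_add)
    show "reducible A (\<lambda>x. a' x + s' x)"
      using deriv.IH s' by blast
  qed
next
  case (exp_mult h a)
  have "reducible A (\<lambda>x. E (h x) * a x + E (h x) * s x)"
    using exp_mult.IH[OF exp_sum_mult[OF exp[OF exp_mult.hyps(1)] exp_mult.prems]] .
  then have "reducible A (\<lambda>x. E (h x) * (a x + s x))"
    by (simp add: distrib_left)
  with subsetD[OF \<open>B \<subseteq> A\<close> exp_mult.hyps(1)] show ?case
    by (rule reducible.exp_mult)
qed

text \<open>Multiplication by \<open>E (- g)\<close> strips the exponential off the last summand and
  leaves its coefficient \<open>a\<close>. That coefficient is reducible by \<open>red\<close>, and
  \<open>reducible_add\<close> carries the other \<open>k\<close> summands along until the induction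
  hypothesis applies.\<close>

lemma reducible_exp_sum:
  assumes "B \<subseteq> A" and exp: "\<And>h. h \<in> B \<Longrightarrow> (\<lambda>x. E (h x)) \<in> A"
    and red: "\<And>a. a \<in> A \<Longrightarrow> reducible B a"
  shows "f \<in> exp_sum A k \<Longrightarrow> reducible A f"
proof (induction k arbitrary: f)
  case 0
  then show ?case by (simp add: reducible.zero)
next
  case (Suc k)
  from Suc.prems obtain s a g where s: "s \<in> exp_sum A k" and ag: "a \<in> A" "g \<in> A"
    and f: "f = (\<lambda>x. s x + a x * E (g x))"
    by (rule exp_sum_SucE)
  have g: "(\<lambda>x. - g x) \<in> A"
    using differential_ring_uminus[OF A ag(2)] .
  have "reducible A (\<lambda>x. a x + E (- g x) * s x)"
    using assms ag exp_sum_mult_exp[OF g s] Suc.IH by (intro reducible_add) auto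
  moreover have "E (- g x) * f x = a x + E (- g x) * s x" for x
    using E_minus[of "g x"] by (simp add: f algebra_simps)
  ultimately show ?case
    using reducible.exp_mult[OF g] by simp
qed

end

section \<open>Towers of nested exponentials\<close>

primrec exp_tower :: "nat \<Rightarrow> ('a \<Rightarrow> 'a) set" where
  "exp_tower 0 = (\<Union>d. poly_fun d)"
| "exp_tower (Suc n) = (\<Union>k. exp_sum (exp_tower n) k)"

lemma differential_ring_exp_tower: "differential_ring (exp_tower n)"
  by (induction n) (simp_all add: differential_ring_poly_fun differential_ring_exp_sum)

lemma exp_tower_Suc: "f \<in> exp_tower n \<Longrightarrow> f \<in> exp_tower (Suc n)"
  using subset_exp_sum[OF differential_ring_exp_tower] by auto

lemma exp_tower_exp: "f \<in> exp_tower n \<Longrightarrow> (\<lambda>x. E (f x)) \<in> exp_tower (Suc n)"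
  using exp_exp_sum[OF differential_ring_exp_tower] by auto

lemma exp_tower_mono: "m \<le> n \<Longrightarrow> f \<in> exp_tower m \<Longrightarrow> f \<in> exp_tower n"
  by (induction rule: dec_induct) (auto simp del: exp_tower.simps intro: exp_tower_Suc)

text \<open>Reducing level \<open>n + 1\<close> uses exponents from level \<open>n\<close>. Carrying
  the closure of level \<open>n\<close> under \<open>E h\<close> for \<open>h\<close> in
  \<open>B\<close> through the induction supplies the hypothesis \<open>exp\<close> of
  \<open>reducible_exp_sum\<close>.\<close>

lemma reducible_exp_tower:
  "\<exists>B \<subseteq> exp_tower n. (\<forall>h\<in>B. (\<lambda>x. E (h x)) \<in> exp_tower n) \<and> (\<forall>f\<in>exp_tower n. reducible B f)"
proof (induction n)
  case 0
  show ?case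
    by (rule exI[of _ "{}"]) (auto intro: reducible_poly_fun)
next
  case (Suc n)
  then obtain B where B: "B \<subseteq> exp_tower n" "\<And>h. h \<in> B \<Longrightarrow> (\<lambda>x. E (h x)) \<in> exp_tower n"
    "\<And>f. f \<in> exp_tower n \<Longrightarrow> reducible B f"
    by blast
  have "reducible (exp_tower n) f" if "f \<in> exp_tower (Suc n)" for f
    using that reducible_exp_sum[OF differential_ring_exp_tower B] by auto
  then show ?case
    using exp_tower_Suc exp_tower_exp by (intro exI[of _ "exp_tower n"]) blast
qed

lemma term_fun_exp_tower: "f \<in> term_fun E \<Longrightarrow> \<exists>n. f \<in> exp_tower n"
proof (induction rule: term_fun.induct)
  case (const c)
  then show ?case using differential_ring_const[OF differential_ring_exp_tower] by blast
next
  case id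
  \<comment> \<open>Two differentiations turn the identity into 1 and then into 0.\<close>
  have "(\<lambda>x. x) \<in> poly_fun (Suc (Suc 0))"
    using term_fun.id is_deriv_id const_poly_fun[of 1 0] unfolding poly_fun.simps(2)[of "Suc 0"]
    by blast
  then have "(\<lambda>x. x) \<in> exp_tower 0"
    unfolding exp_tower.simps by blast
  then show ?case by blast
next
  case (add f g)
  then obtain m n where "f \<in> exp_tower m" "g \<in> exp_tower n" by blast
  then have "f \<in> exp_tower (max m n)" "g \<in> exp_tower (max m n)"
    by (auto intro: exp_tower_mono[rotated])
  then show ?case
    using differential_ring_add[OF differential_ring_exp_tower] by blast
next
  case (mult f g)
  then obtain m n where "f \<in> exp_tower m" "g \<in> exp_tower n" by blast
  then have "f \<in> exp_tower (max m n)" "g \<in> exp_tower (max m n)"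
    by (auto intro: exp_tower_mono[rotated])
  then show ?case
    using differential_ring_mult[OF differential_ring_exp_tower] by blast
next
  case (exp f)
  then show ?case using exp_tower_exp by blast
qed

lemma term_fun_piecewise_const_sgn:
  "f \<in> term_fun E \<Longrightarrow> piecewise_const (\<lambda>x. sgn (f x))"
  using term_fun_exp_tower reducible_exp_tower reducible_piecewise_const_sgn by meson

section \<open>The nonnegative part as a model of IOpen(exp)\<close>

lemma exp_arith_structure_nonneg_part:
  assumes "exponential_integer_part E M"
  shows "exp_arith_structure (nonneg_part M) 0 (\<lambda>x. x + 1) (+) (*) E"
  using assms
  unfolding exponential_integer_part_def integer_part_def discretely_ordered_subring_def
  by unfold_locales (auto simp: nonneg_part_def)

context
  fixes M :: "'a set"
  assumes M: "exponential_integer_part E M"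
begin

interpretation exp_arith_structure "nonneg_part M" 0 "\<lambda>x. x + 1" "(+)" "(*)" "(\<le>)" E
  by (rule exp_arith_structure_nonneg_part[OF M])

text \<open>Arithmetic terms are evaluated on the whole field, since break points may lie outside
  \<open>M\<close>. The successor becomes addition of the constant 1.\<close>

lemma eval_term_fun: "(\<lambda>z. eval (e(i := z)) t) \<in> term_fun E"
proof (induction t)
  case (Var n)
  show ?case
    by (cases "n = i") (simp_all add: term_fun.id term_fun.const)
next
  case (Exp t)
  then show ?case
    using term_fun.exp by (simp del: fun_upd_apply)
qed (simp_all add: term_fun.intros del: fun_upd_apply)

text \<open>An atomic formula depends only on the sign of the difference of its two sides:
  \<open>Eq\<close> means sign 0, and \<open>Le\<close> means a sign other than 1.\<close>

lemma sat_piecewise_const: "piecewise_const (\<lambda>z. sat (e(i := z)) p)"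
proof (induction p)
  case (Eq s t)
  have "piecewise_const (\<lambda>z. sgn (eval (e(i := z)) s - eval (e(i := z)) t) = 0)"
    by (intro piecewise_const_compose[where h = "\<lambda>u. u = 0"] term_fun_piecewise_const_sgn
        term_fun_diff eval_term_fun)
  then show ?case by (simp add: sgn_0_0 del: fun_upd_apply)
next
  case (Le s t)
  have "piecewise_const (\<lambda>z. sgn (eval (e(i := z)) s - eval (e(i := z)) t) \<noteq> 1)"
    by (intro piecewise_const_compose[where h = "\<lambda>u. u \<noteq> 1"] term_fun_piecewise_const_sgn
        term_fun_diff eval_term_fun)
  then show ?case by (simp add: sgn_1_pos not_less del: fun_upd_apply)
next
  case (Neg p)
  then show ?case
    using piecewise_const_compose[where h = Not] by (simp del: fun_upd_apply)
next
  case (Conj p q)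
  then show ?case
    using piecewise_const_combine[where h = "(\<and>)"] by (simp del: fun_upd_apply)
next
  case (Disj p q)
  then show ?case
    using piecewise_const_combine[where h = "(\<or>)"] by (simp del: fun_upd_apply)
next
  case (Impl p q)
  then show ?case
    using piecewise_const_combine[where h = "(\<longrightarrow>)"] by (simp del: fun_upd_apply)
qed

lemma IOpen_exp_model_nonneg_part:
  "IOpen_exp_model (nonneg_part M) 0 (\<lambda>x. x + 1) (+) (*) (\<le>) E"
proof
  have ip: "integer_part M"
    using M unfolding exponential_integer_part_def by blast
  have ring: "0 \<in> M" "1 \<in> M" "\<And>a b. a \<in> M \<Longrightarrow> b \<in> M \<Longrightarrow> a + b \<in> M" "\<And>a. a \<in> M \<Longrightarrow> - a \<in> M"
    and discrete: "\<And>a. a \<in> M \<Longrightarrow> 0 < a \<Longrightarrow> 1 \<le> a"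
    using ip unfolding integer_part_def discretely_ordered_subring_def by auto
  have diff: "a - b \<in> M" if "a \<in> M" "b \<in> M" for a b
    using ring(3)[of a "- b"] ring(4) that by simp
  show "\<forall>x\<in>nonneg_part M. x + 1 \<noteq> 0"
    by (auto simp: nonneg_part_def add_nonneg_eq_0_iff)
  show "\<forall>x\<in>nonneg_part M. x \<noteq> 0 \<longrightarrow> (\<exists>y\<in>nonneg_part M. x = y + 1)"
  proof (intro ballI impI)
    fix x
    assume "x \<in> nonneg_part M" "x \<noteq> 0"
    then have "x - 1 \<in> nonneg_part M"
      using discrete[of x] diff ring(2) by (auto simp: nonneg_part_def)
    then show "\<exists>y\<in>nonneg_part M. x = y + 1"
      by (intro bexI[of _ "x - 1"]) auto
  qed
  show "\<forall>x\<in>nonneg_part M. \<forall>y\<in>nonneg_part M. x \<le> y \<longleftrightarrow> (\<exists>r\<in>nonneg_part M. r + x = y)"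
  proof (intro ballI iffI)
    fix x y
    assume "x \<in> nonneg_part M" "y \<in> nonneg_part M" "x \<le> y"
    then show "\<exists>r\<in>nonneg_part M. r + x = y"
      using diff by (intro bexI[of _ "y - x"]) (auto simp: nonneg_part_def)
  qed (auto simp: nonneg_part_def)
  show "\<forall>p i e. range e \<subseteq> nonneg_part M \<longrightarrow>
      sat (e(i := 0)) p \<and> (\<forall>x\<in>nonneg_part M. sat (e(i := x)) p \<longrightarrow> sat (e(i := x + 1)) p) \<longrightarrow>
      (\<forall>x\<in>nonneg_part M. sat (e(i := x)) p)"
  proof (intro allI impI ballI)
    fix p i e x
    assume "sat (e(i := 0)) p \<and>
      (\<forall>x\<in>nonneg_part M. sat (e(i := x)) p \<longrightarrow> sat (e(i := x + 1)) p)"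
      and x: "x \<in> nonneg_part M"
    then show "sat (e(i := x)) p"
      by (intro integer_part_induct[OF ip sat_piecewise_const _ _ x]) auto
  qed
\<comment> \<open>The doubling axiom E2 comes from \<open>E (x + 1) = E x * E 1\<close> and
  \<open>E 1 = 2\<close>.\<close>
qed (simp_all add: E_0 E_add E_1 algebra_simps)

end

end

theorem theorem2p5:
  fixes E :: "'a::linordered_field \<Rightarrow> 'a" and M :: "'a set"
  assumes "exponential_field E"
    and "MaxVal_exp E"
    and "E 1 = 2"
    and "discretely_ordered_subring M"
    and "exponential_integer_part E M"
  shows "IOpen_exp_model (nonneg_part M) 0 (\<lambda>x. x + 1) (+) (*) (\<le>) E"
proof -
  interpret maxval_exp_field E
    using assms by unfold_locales
  show ?thesis
    using IOpen_exp_model_nonneg_part[OF assms(5)] .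
qed

end
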